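(* Let $\mathcal{H}$ be a $k$-uniform hypergraph on $n$ vertices and let $\overline{\mathcal{H}}$ be its complement. Then $$\frac{\sqrt{k}\binom{n}{k}}{\sqrt{\binom{n-1}{k-1}}} \le \mathtt{BE}(\mathcal{H}) + \mathtt{BE}(\overline{\mathcal{H}}) \le k\sqrt{\frac{2}{n}\binom{n}{k}} + \sqrt{\frac{2k(n-1)(n-k)}{n}\binom{n}{k}}.$$ The first inequality is an equality if and only if $\mathcal{H}$ has at most $k$ vertices and one edge.
   Context: A hypergraph $\mathcal{H}=(V,E)$ has a finite vertex set $V$ and an edge set $E\subseteq 2^V$; it is $k$-uniform ($k\ge2$) if every edge has exactly $k$ vertices. The complement $\overline{\mathcal{H}}$ of a $k$-uniform hypergraph on vertex set $V$ is the $k$-uniform hypergraph on $V$ whose edges are the $k$-subsets of $V$ that are not edges of $\mathcal{H}$. Its incidence matrix $\mathbf{B}$ is the $|V|\times|E|$ matrix with $b(v,e)=1$ if $v\in e$ and $0$ otherwise. The incidence energy $\mathtt{BE}(\mathcal{H})$ is the sum of the singular values of $\mathbf{B}$ (i.e. of the square roots of the eigenvalues of $\mathbf{B}\mathbf{B}^T$) if $\mathcal{H}$ has at least one edge, and $0$ otherwise. *)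

theory Defs
  imports Complex_Main "Jordan_Normal_Form.Char_Poly"
begin

definition hypergraph :: "'a set \<Rightarrow> 'a set set \<Rightarrow> bool" where
  "hypergraph V E \<longleftrightarrow> finite V \<and> E \<subseteq> Pow V"

definition uniform_hypergraph :: "nat \<Rightarrow> 'a set \<Rightarrow> 'a set set \<Rightarrow> bool" where
  "uniform_hypergraph k V E \<longleftrightarrow> hypergraph V E \<and> (\<forall>e\<in>E. card e = k)"

definition complement_edges :: "nat \<Rightarrow> 'a set \<Rightarrow> 'a set set \<Rightarrow> 'a set set" where
  "complement_edges k V E = {e. e \<subseteq> V \<and> card e = k \<and> e \<notin> E}"

definition incidence_matrix :: "'a list \<Rightarrow> 'a set list \<Rightarrow> real mat" where
  "incidence_matrix vs es =
     mat (length vs) (length es) (\<lambda>(i, j). if vs ! i \<in> es ! j then 1 else 0)"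

text \<open>With multiplicity. For a real matrix B with m rows, the characteristic polynomial of
  \<open>B B\<^sup>T\<close> splits over the reals, so this multiset has exactly m elements; compared with the
  convention of min(m, number of columns) singular values it may contain extra zeros.\<close>

definition singular_values :: "real mat \<Rightarrow> real multiset" where
  "singular_values B = image_mset sqrt (proots (char_poly (B * transpose_mat B)))"

text \<open>Matrices have rows and columns indexed by initial segments of the naturals, so V and E
  are enumerated by arbitrarily chosen lists; lemma \<open>incidence_energy_eq\<close> below shows
  that the choice is irrelevant.\<close>

definition enumeration :: "'a set \<Rightarrow> 'a list" where
  "enumeration S = (SOME xs. set xs = S \<and> distinct xs)"

definition incidence_energy :: "'a set \<Rightarrow> 'a set set \<Rightarrow> real" where
  "incidence_energy V E =
     (if E = {} then 0
      else \<Sum>\<^sub># (singular_values (incidence_matrix (enumeration V) (enumeration E))))"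

lemma enumeration:
  assumes "finite S"
  shows "set (enumeration S) = S" "distinct (enumeration S)"
  using someI_ex[OF finite_distinct_list[OF assms]] unfolding enumeration_def by auto

lemma incidence_gram:
  assumes "distinct es"
  shows "incidence_matrix vs es * transpose_mat (incidence_matrix vs es) =
    mat (length vs) (length vs)
      (\<lambda>(i, j). real (card {e \<in> set es. vs ! i \<in> e \<and> vs ! j \<in> e}))"
proof (rule eq_matI, goal_cases)
  case (1 i j)
  have "(\<Sum>l<length es. (if vs ! i \<in> es ! l then 1 else 0) * (if vs ! j \<in> es ! l then 1 else (0::real)))
      = (\<Sum>e\<in>set es. (if vs ! i \<in> e then 1 else 0) * (if vs ! j \<in> e then 1 else (0::real)))"
    by (rule sum.reindex_bij_betw[OF bij_betw_nth[OF assms refl refl]])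
  also have "\<dots> = (\<Sum>e\<in>set es. if vs ! i \<in> e \<and> vs ! j \<in> e then 1 else (0::real))"
    by (rule sum.cong) auto
  also have "\<dots> = real (card {e \<in> set es. vs ! i \<in> e \<and> vs ! j \<in> e})"
    by (simp add: sum.If_cases Int_def)
  finally show ?case
    using 1 by (simp add: incidence_matrix_def scalar_prod_def lessThan_atLeast0)
qed (auto simp: incidence_matrix_def)

lemma similar_reindex:
  fixes f :: "'a \<Rightarrow> 'a \<Rightarrow> real"
  assumes d: "distinct xs" "distinct ys" and s: "set xs = set ys"
  shows "similar_mat (mat (length xs) (length xs) (\<lambda>(i, j). f (xs ! i) (xs ! j)))
                     (mat (length ys) (length ys) (\<lambda>(i, j). f (ys ! i) (ys ! j)))"
proof -
  define n where "n = length ys"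
  have len: "length xs = n" using d s n_def by (metis distinct_card)
  define P where "P = (mat n n (\<lambda>(i, j). if xs ! i = ys ! j then 1 else 0) :: real mat)"
  define Q where "Q = (mat n n (\<lambda>(i, j). if ys ! i = xs ! j then 1 else 0) :: real mat)"
  have ys: "(\<Sum>l<n. h (ys ! l)) = sum h (set ys)" for h :: "'a \<Rightarrow> real"
    unfolding n_def by (rule sum.reindex_bij_betw[OF bij_betw_nth[OF d(2) refl refl]])
  have xs: "(\<Sum>l<n. h (xs ! l)) = sum h (set ys)" for h :: "'a \<Rightarrow> real"
    unfolding len[symmetric] s[symmetric]
    by (rule sum.reindex_bij_betw[OF bij_betw_nth[OF d(1) refl refl]])
  have mem: "i < n \<Longrightarrow> xs ! i \<in> set ys" "i < n \<Longrightarrow> ys ! i \<in> set ys" for i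
    using len n_def s by (metis nth_mem)+
  have eqx: "i < n \<Longrightarrow> j < n \<Longrightarrow> xs ! i = xs ! j \<longleftrightarrow> i = j" for i j
    using d len by (simp add: nth_eq_iff_index_eq)
  have eqy: "i < n \<Longrightarrow> j < n \<Longrightarrow> ys ! i = ys ! j \<longleftrightarrow> i = j" for i j
    using d n_def by (simp add: nth_eq_iff_index_eq)
  let ?A = "mat n n (\<lambda>(i, j). f (xs ! i) (xs ! j))"
  let ?B = "mat n n (\<lambda>(i, j). f (ys ! i) (ys ! j))"
  have PQ: "P * Q = 1\<^sub>m n"
  proof (rule eq_matI, goal_cases)
    case (1 i j)
    then show ?case
      using ys[of "\<lambda>y. (if xs ! i = y then 1 else 0) * (if y = xs ! j then 1 else 0)"] mem eqx
      by (simp add: P_def Q_def scalar_prod_def lessThan_atLeast0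
          if_distrib[where f = "\<lambda>x. x * _"] if_distrib[where f = "\<lambda>x. _ * x"] cong: if_cong)
  qed (auto simp: P_def Q_def)
  have QP: "Q * P = 1\<^sub>m n"
  proof (rule eq_matI, goal_cases)
    case (1 i j)
    then show ?case
      using xs[of "\<lambda>y. (if ys ! i = y then 1 else 0) * (if y = ys ! j then 1 else 0)"] mem eqy
      by (simp add: P_def Q_def scalar_prod_def lessThan_atLeast0
          if_distrib[where f = "\<lambda>x. x * _"] if_distrib[where f = "\<lambda>x. _ * x"] cong: if_cong)
  qed (auto simp: P_def Q_def)
  have PB: "P * ?B = mat n n (\<lambda>(i, j). f (xs ! i) (ys ! j))"
  proof (rule eq_matI, goal_cases)
    case (1 i j)
    then show ?case
      using ys[of "\<lambda>y. (if xs ! i = y then 1 else 0) * f y (ys ! j)"] mem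
      by (simp add: P_def scalar_prod_def lessThan_atLeast0 if_distrib[where f = "\<lambda>x. x * _"]
          cong: if_cong)
  qed (auto simp: P_def)
  have PBQ: "?A = P * ?B * Q"
    unfolding PB
  proof (rule eq_matI, goal_cases)
    case (1 i j)
    then show ?case
      using ys[of "\<lambda>y. f (xs ! i) y * (if y = xs ! j then 1 else 0)"] mem
      by (simp add: Q_def scalar_prod_def lessThan_atLeast0
          if_distrib[where f = "\<lambda>x. x * _"] if_distrib[where f = "\<lambda>x. _ * x"] cong: if_cong)
  qed (auto simp: Q_def)
  have "similar_mat_wit ?A ?B P Q"
    by (rule similar_mat_witI[OF PQ QP PBQ]) (auto simp: P_def Q_def)
  then show ?thesis
    unfolding similar_mat_def len n_def[symmetric] by blast
qed

lemma incidence_energy_eq: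
  assumes "distinct vs" "distinct es" "es \<noteq> []"
  shows "incidence_energy (set vs) (set es) = \<Sum>\<^sub># (singular_values (incidence_matrix vs es))"
proof -
  have d: "distinct (enumeration (set vs))" "distinct (enumeration (set es))"
    and s: "set (enumeration (set vs)) = set vs" "set (enumeration (set es)) = set es"
    by (simp_all add: enumeration)
  show ?thesis
    unfolding incidence_energy_def singular_values_def incidence_gram[OF assms(2)]
      incidence_gram[OF d(2)] s
    using assms(3) char_poly_similar[OF similar_reindex[OF d(1) assms(1) s(1),
          of "\<lambda>u v. real (card {e \<in> set es. u \<in> e \<and> v \<in> e})"]]
    by simp
qed

end

theory Submission
  imports Defs "Jordan_Normal_Form.Schur_Decomposition" "HOL-Analysis.Convex"
begin

text \<open>
  Let G be the Gram matrix of the incidence matrix of a hypergraph with m edges, n vertices and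
  eigenvalues \<open>\<lambda>\<close>. Its entries are the codegrees, its trace is k m, and double counting gives
  tr \<open>G\<^sup>2 \<le> M\<close> tr G with \<open>M = k\<close> C(n-1,k-1), strictly if there is an edge and k < n. Since
  \<open>(t - 1)\<^sup>2 (t + 2) \<ge> 0\<close>, one has \<open>sqrt \<lambda> \<ge> 3 \<lambda> / (2 sqrt M) - \<lambda>\<^sup>2 / (2 M sqrt M)\<close>; summing over the
  spectrum bounds the energy below by \<open>k m / sqrt M\<close>. For the upper bound, the largest eigenvalue is
  at least the Rayleigh quotient \<open>k\<^sup>2 m / n\<close> of the all-ones vector, and Cauchy-Schwarz controls the
  other n - 1 eigenvalues (the Koolen-Moulton argument). Both bounds are then added over the
  hypergraph and its complement.
\<close>

section \<open>Spectra of symmetric matrices\<close>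

definition trace_mat :: "'a :: comm_monoid_add mat \<Rightarrow> 'a" where
  "trace_mat A = (\<Sum>i<dim_row A. A $$ (i, i))"

lemma index_mult_mat_sum:
  assumes "A \<in> carrier_mat n m" "B \<in> carrier_mat m p" "i < n" "j < p"
  shows "(A * B) $$ (i, j) = (\<Sum>l<m. A $$ (i, l) * B $$ (l, j))"
  using assms by (simp add: scalar_prod_def lessThan_atLeast0)

lemma trace_mat_mult:
  fixes A B :: "'a :: comm_semiring_0 mat"
  assumes "A \<in> carrier_mat n m" "B \<in> carrier_mat m n"
  shows "trace_mat (A * B) = (\<Sum>i<n. \<Sum>l<m. A $$ (i, l) * B $$ (l, i))"
  using assms by (simp add: trace_mat_def scalar_prod_def lessThan_atLeast0)

lemma trace_mat_mult_commute:
  fixes A B :: "'a :: comm_semiring_0 mat"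
  assumes "A \<in> carrier_mat n m" "B \<in> carrier_mat m n"
  shows "trace_mat (A * B) = trace_mat (B * A)"
  unfolding trace_mat_mult[OF assms] trace_mat_mult[OF assms(2,1)]
  by (subst sum.swap) (simp add: mult.commute)

lemma trace_mat_similar:
  fixes A B :: "'a :: comm_semiring_1 mat"
  assumes "A \<in> carrier_mat n n" "similar_mat_wit A B P Q"
  shows "trace_mat A = trace_mat B"
proof -
  note s = similar_mat_witD2[OF assms]
  have "trace_mat A = trace_mat (P * (B * Q))"
    using s by (metis assoc_mult_mat)
  also have "\<dots> = trace_mat (B * Q * P)"
    using s by (intro trace_mat_mult_commute[of _ n n]) auto
  also have "B * Q * P = B"
    using s by (metis assoc_mult_mat right_mult_one_mat)
  finally show ?thesis .
qed

lemma sum_list_diag_mat: "sum_list (diag_mat A) = trace_mat A"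
  by (simp add: diag_mat_def trace_mat_def interv_sum_list_conv_sum_set_nat lessThan_atLeast0)

text \<open>Schur decomposition puts the given roots on the diagonal of a triangular matrix similar
  to \<open>A\<close>, and the trace is invariant under similarity.\<close>

lemma trace_mat_eq_sum_roots:
  fixes A :: "real mat"
  assumes A: "A \<in> carrier_mat n n" and cp: "char_poly A = (\<Prod>e\<leftarrow>es. [:- e, 1:])"
  shows "trace_mat A = sum_list es"
proof -
  obtain T P Q where "schur_decomposition A es = (T, P, Q)"
    by (metis prod_cases3)
  from schur_decomposition[OF A cp this] show ?thesis
    using trace_mat_similar[OF A] sum_list_diag_mat by metis
qed

lemma upper_triangular_square:
  fixes T :: "'a :: comm_semiring_1 mat"
  assumes T: "T \<in> carrier_mat n n" and ut: "upper_triangular T"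
  shows "upper_triangular (T * T)" "diag_mat (T * T) = map (\<lambda>x. x\<^sup>2) (diag_mat T)"
proof -
  \<comment> \<open>If \<open>l < i\<close> the first factor lies below the diagonal; otherwise
    \<open>j < l\<close> and the second one does.\<close>
  have z: "T $$ (i, l) * T $$ (l, j) = 0" if "i < n" "l < n" "j \<le> i" "l \<noteq> i \<or> j < i" for i l j
    using upper_triangularD[OF ut, of l i] upper_triangularD[OF ut, of j l] T that
    by (cases "l < i") auto
  show "upper_triangular (T * T)"
  proof
    fix i j assume "j < i" "i < dim_row (T * T)"
    then show "(T * T) $$ (i, j) = 0"
      using T z by (subst index_mult_mat_sum[OF T T]) (auto intro!: sum.neutral)
  qed
  have "(T * T) $$ (i, i) = (T $$ (i, i))\<^sup>2" if i: "i < n" for i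
  proof -
    have "(\<Sum>l<n. T $$ (i, l) * T $$ (l, i)) = (\<Sum>l<n. if l = i then (T $$ (i, i))\<^sup>2 else 0)"
      using z i by (intro sum.cong) (auto simp: power2_eq_square)
    then show ?thesis
      using i by (subst index_mult_mat_sum[OF T T]) auto
  qed
  then show "diag_mat (T * T) = map (\<lambda>x. x\<^sup>2) (diag_mat T)"
    using T by (auto simp: diag_mat_def)
qed

text \<open>The conjugation that makes \<open>A\<close> triangular also makes its square triangular,
  with squared diagonal.\<close>

lemma char_poly_square:
  fixes A :: "real mat"
  assumes A: "A \<in> carrier_mat n n" and cp: "char_poly A = (\<Prod>e\<leftarrow>es. [:- e, 1:])"
  shows "char_poly (A * A) = (\<Prod>e\<leftarrow>map (\<lambda>x. x\<^sup>2) es. [:- e, 1:])"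
proof -
  obtain T P Q where "schur_decomposition A es = (T, P, Q)"
    by (metis prod_cases3)
  from schur_decomposition[OF A cp this]
  have sim: "similar_mat_wit A T P Q" and ut: "upper_triangular T" and d: "diag_mat T = es"
    by auto
  have T: "T \<in> carrier_mat n n"
    using similar_mat_witD2[OF A sim] by auto
  have "similar_mat_wit (A ^\<^sub>m 2) (T ^\<^sub>m 2) P Q"
    using similar_mat_wit_pow[OF sim] .
  then have "similar_mat (A * A) (T * T)"
    using A T by (auto simp: similar_mat_def numeral_2_eq_2)
  then have "char_poly (A * A) = char_poly (T * T)"
    by (rule char_poly_similar)
  also have "\<dots> = (\<Prod>e\<leftarrow>diag_mat (T * T). [:- e, 1:])"
    using T upper_triangular_square[OF T ut] by (intro char_poly_upper_triangular) auto
  finally show ?thesis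
    using upper_triangular_square[OF T ut] d by simp
qed

lemma trace_mat_square_eq_sum_roots:
  fixes A :: "real mat"
  assumes A: "A \<in> carrier_mat n n" and cp: "char_poly A = (\<Prod>e\<leftarrow>es. [:- e, 1:])"
  shows "trace_mat (A * A) = (\<Sum>e\<leftarrow>es. e\<^sup>2)"
  using trace_mat_eq_sum_roots[OF mult_carrier_mat[OF A A] char_poly_square[OF A cp]] by simp

lemma length_roots_char_poly:
  fixes A :: "real mat"
  assumes A: "A \<in> carrier_mat n n" and cp: "char_poly A = (\<Prod>e\<leftarrow>es. [:- e, 1:])"
  shows "length es = n"
  using degree_monic_char_poly[OF A] degree_linear_factors[of uminus es] cp by simp

lemma proots_prod_linear:
  "proots (\<Prod>e\<leftarrow>es. [:- e, 1:]) = mset (es :: 'a :: idom list)"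
proof (induction es)
  case (Cons e es)
  have "(\<Prod>e\<leftarrow>es. [:- e, 1:]) \<noteq> 0" by (auto simp: prod_list_zero_iff)
  with Cons show ?case by (simp add: proots_mult del: mult_pCons_left)
qed simp

section \<open>Rayleigh bound for symmetric matrices\<close>

definition quad_form :: "real mat \<Rightarrow> (nat \<Rightarrow> real) \<Rightarrow> real" where
  "quad_form A w = (\<Sum>i<dim_row A. w i * (\<Sum>j<dim_col A. A $$ (i, j) * w j))"

text \<open>By symmetry, w^T A A w is the squared norm of A w.\<close>

lemma quad_form_square:
  assumes A: "A \<in> carrier_mat n n" and sym: "transpose_mat A = A"
  shows "quad_form (A * A) w = (\<Sum>i<n. (\<Sum>j<n. A $$ (i, j) * w j)\<^sup>2)"
proof -
  have s: "A $$ (i, j) = A $$ (j, i)" if "i < n" "j < n" for i j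
    using arg_cong[OF sym, of "\<lambda>M. M $$ (i, j)"] A that by auto
  have "quad_form (A * A) w = (\<Sum>i<n. w i * (\<Sum>j<n. (\<Sum>l<n. A $$ (i, l) * A $$ (l, j)) * w j))"
    using A unfolding quad_form_def
    by (auto intro!: sum.cong simp: index_mult_mat_sum[OF A A] simp del: index_mult_mat(1))
  also have "\<dots> = (\<Sum>i<n. \<Sum>j<n. \<Sum>l<n. w i * A $$ (l, i) * (A $$ (l, j) * w j))"
    by (auto intro!: sum.cong simp: sum_distrib_left sum_distrib_right s mult_ac)
  also have "\<dots> = (\<Sum>i<n. \<Sum>l<n. \<Sum>j<n. w i * A $$ (l, i) * (A $$ (l, j) * w j))"
    by (rule sum.cong[OF refl], rule sum.swap)
  also have "\<dots> = (\<Sum>l<n. \<Sum>i<n. \<Sum>j<n. w i * A $$ (l, i) * (A $$ (l, j) * w j))"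
    by (rule sum.swap)
  also have "\<dots> = (\<Sum>l<n. (\<Sum>j<n. A $$ (l, j) * w j)\<^sup>2)"
    by (auto intro!: sum.cong simp: power2_eq_square sum_product mult_ac)
  finally show ?thesis .
qed

lemma quad_form_squared_le:
  assumes A: "A \<in> carrier_mat n n" and sym: "transpose_mat A = A"
  shows "(quad_form A w)\<^sup>2 \<le> (\<Sum>i<n. (w i)\<^sup>2) * quad_form (A * A) w"
  unfolding quad_form_square[OF assms] using A
  by (auto simp: quad_form_def intro!: Cauchy_Schwarz_ineq_sum)

text \<open>Cauchy-Schwarz in each row bounds |A w|^2 by |w|^2 times the squared Frobenius norm of
  \<open>A\<close>, which for symmetric \<open>A\<close> is the trace of its square.\<close>

lemma quad_form_square_le_trace:
  assumes A: "A \<in> carrier_mat n n" and sym: "transpose_mat A = A"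
  shows "quad_form (A * A) w \<le> trace_mat (A * A) * (\<Sum>i<n. (w i)\<^sup>2)"
proof -
  have s: "A $$ (i, j) = A $$ (j, i)" if "i < n" "j < n" for i j
    using arg_cong[OF sym, of "\<lambda>M. M $$ (i, j)"] A that by auto
  have "quad_form (A * A) w \<le> (\<Sum>i<n. (\<Sum>j<n. (A $$ (i, j))\<^sup>2) * (\<Sum>j<n. (w j)\<^sup>2))"
    unfolding quad_form_square[OF assms] by (intro sum_mono Cauchy_Schwarz_ineq_sum)
  also have "\<dots> = trace_mat (A * A) * (\<Sum>i<n. (w i)\<^sup>2)"
    unfolding trace_mat_mult[OF A A] sum_distrib_right[symmetric]
    by (auto intro!: sum.cong arg_cong2[where f = "(*)"] simp: s power2_eq_square)
  finally show ?thesis .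
qed

text \<open>Squaring A squares the roots, and Cauchy-Schwarz compares the quadratic forms of A and its
  square. Iterating makes the factor n negligible, which yields the Rayleigh bound without an
  orthogonal eigenbasis.\<close>

lemma quad_form_power_le:
  fixes A :: "real mat"
  assumes "A \<in> carrier_mat n n" "transpose_mat A = A"
    and "char_poly A = (\<Prod>e\<leftarrow>es. [:- e, 1:])" and "\<And>e. e \<in> set es \<Longrightarrow> \<bar>e\<bar> \<le> \<mu>"
  shows "(quad_form A w) ^ 2 ^ Suc j \<le> real n * (\<mu> * (\<Sum>i<n. (w i)\<^sup>2)) ^ 2 ^ Suc j"
  using assms
proof (induction j arbitrary: A es \<mu>)
  case 0
  let ?W = "\<Sum>i<n. (w i)\<^sup>2"
  have W: "0 \<le> ?W" by (simp add: sum_nonneg)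
  \<comment> \<open>The crude bound by the trace occurs only in this base case, so the factor
    \<open>n\<close> enters once, whatever the number of squarings.\<close>
  have "(\<Sum>e\<leftarrow>es. e\<^sup>2) \<le> (\<Sum>e\<leftarrow>es. \<mu>\<^sup>2)"
    using 0(4) by (intro sum_list_mono) (metis abs_ge_zero abs_le_square_iff abs_of_nonneg order_trans)
  also have "\<dots> = n * \<mu>\<^sup>2"
    using length_roots_char_poly[OF 0(1,3)] by (simp add: sum_list_triv)
  finally have t: "trace_mat (A * A) \<le> n * \<mu>\<^sup>2"
    using trace_mat_square_eq_sum_roots[OF 0(1,3)] by simp
  have "(quad_form A w)\<^sup>2 \<le> ?W * quad_form (A * A) w"
    by (rule quad_form_squared_le[OF 0(1,2)])
  also have "\<dots> \<le> ?W * (trace_mat (A * A) * ?W)"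
    by (intro mult_left_mono quad_form_square_le_trace[OF 0(1,2)] W)
  also have "\<dots> \<le> ?W * (n * \<mu>\<^sup>2 * ?W)"
    by (intro mult_left_mono mult_right_mono t W)
  finally show ?case by (simp add: power2_eq_square mult_ac)
next
  case (Suc j)
  let ?W = "\<Sum>i<n. (w i)\<^sup>2"
  have W: "0 \<le> ?W" by (simp add: sum_nonneg)
  have "(quad_form A w) ^ 2 ^ Suc (Suc j) = ((quad_form A w)\<^sup>2) ^ 2 ^ Suc j"
    by (simp flip: power_mult)
  also have "\<dots> \<le> (?W * quad_form (A * A) w) ^ 2 ^ Suc j"
    by (intro power_mono quad_form_squared_le[OF Suc(2,3)]) simp
  also have "\<dots> = ?W ^ 2 ^ Suc j * (quad_form (A * A) w) ^ 2 ^ Suc j"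
    by (simp add: power_mult_distrib)
  also have "\<dots> \<le> ?W ^ 2 ^ Suc j * (real n * (\<mu>\<^sup>2 * ?W) ^ 2 ^ Suc j)"
  proof (intro mult_left_mono Suc.IH[of "A * A" "map (\<lambda>x. x\<^sup>2) es" "\<mu>\<^sup>2"])
    show "transpose_mat (A * A) = A * A"
      using transpose_mult[OF Suc(2) Suc(2)] Suc(3) by simp
    show "\<bar>e\<bar> \<le> \<mu>\<^sup>2" if "e \<in> set (map (\<lambda>x. x\<^sup>2) es)" for e
      using that power_mono[OF Suc(5) abs_ge_zero, of _ 2] by auto
    show "char_poly (A * A) = (\<Prod>e\<leftarrow>map (\<lambda>x. x\<^sup>2) es. [:- e, 1:])"
      by (rule char_poly_square[OF Suc(2,4)])
    show "A * A \<in> carrier_mat n n"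
      using Suc(2) by simp
    show "0 \<le> ?W ^ 2 ^ Suc j"
      by (rule zero_le_power[OF W])
  qed
  also have "\<dots> = real n * (?W * (\<mu>\<^sup>2 * ?W)) ^ 2 ^ Suc j"
    by (subst power_mult_distrib[of ?W]) (rule mult.left_commute)
  also have "?W * (\<mu>\<^sup>2 * ?W) = (\<mu> * ?W)\<^sup>2"
    by (simp add: power2_eq_square mult_ac)
  also have "((\<mu> * ?W)\<^sup>2) ^ 2 ^ Suc j = (\<mu> * ?W) ^ 2 ^ Suc (Suc j)"
    by (simp flip: power_mult)
  finally show ?case .
qed

text \<open>A violation would give a ratio q / r > 1, whose powers are unbounded, while
  \<open>quad_form_power_le\<close> keeps infinitely many of them at most \<open>n\<close>. The case
  r = 0 is settled separately.\<close>

lemma quad_form_le_max_root: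
  fixes A :: "real mat"
  assumes "A \<in> carrier_mat n n" "transpose_mat A = A"
    and "char_poly A = (\<Prod>e\<leftarrow>es. [:- e, 1:])" and "\<And>e. e \<in> set es \<Longrightarrow> \<bar>e\<bar> \<le> \<mu>" and "0 \<le> \<mu>"
  shows "quad_form A w \<le> \<mu> * (\<Sum>i<n. (w i)\<^sup>2)"
proof (rule ccontr)
  define q where "q = quad_form A w"
  define r where "r = \<mu> * (\<Sum>i<n. (w i)\<^sup>2)"
  assume "\<not> ?thesis"
  then have rq: "r < q" by (simp add: q_def r_def)
  have r: "0 \<le> r" using assms(5) by (simp add: r_def sum_nonneg)
  have le: "q ^ 2 ^ Suc j \<le> n * r ^ 2 ^ Suc j" for j
    unfolding q_def r_def by (rule quad_form_power_le[OF assms(1-4)])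
  show False
  proof (cases "r = 0")
    case True
    with le[of 0] rq show False by simp
  next
    case False
    then have "1 < q / r" using rq r by simp
    then obtain m where m: "real n < (q / r) ^ m"
      using real_arch_pow by blast
    \<comment> \<open>Only exponents \<open>2 ^ Suc j\<close> are available, so the Archimedean
      exponent \<open>m\<close> is enlarged to one of them.\<close>
    also have "m \<le> 2 ^ Suc m"
      by (meson le_trans less_exp nat_less_le le_SucI power_increasing one_le_numeral lessI less_imp_le)
    then have "(q / r) ^ m \<le> (q / r) ^ 2 ^ Suc m"
      using \<open>1 < q / r\<close> by (intro power_increasing) auto
    also have "\<dots> \<le> n"
      using le[of m] r False by (simp add: power_divide divide_le_eq)
    finally show False by simp
  qed
qed

section \<open>Gram matrices have a nonnegative real spectrum\<close>

lemma eigenvalue_gram_nonneg: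
  fixes B :: "real mat"
  assumes B: "B \<in> carrier_mat n m"
    and ev: "eigenvalue (map_mat complex_of_real (B * transpose_mat B)) a"
  shows "\<exists>r\<ge>0. a = complex_of_real r"
proof -
  let ?G = "map_mat complex_of_real (B * transpose_mat B)"
  from ev obtain v where v: "v \<in> carrier_vec n" "v \<noteq> 0\<^sub>v n" "?G *\<^sub>v v = a \<cdot>\<^sub>v v"
    using B by (auto simp: eigenvalue_def eigenvector_def)
  define x where "x = vec_index v"
  define b where "b i l = complex_of_real (B $$ (i, l))" for i l
  define y where "y l = (\<Sum>j<n. b j l * x j)" for l
  have e: "(\<Sum>j<n. (\<Sum>l<m. b i l * b j l) * x j) = a * x i" if i: "i < n" for i
  proof -
    have "vec_index (?G *\<^sub>v v) i = a * x i"
      using i v by (simp add: x_def)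
    then show ?thesis
      using B v(1) i by (simp add: scalar_prod_def lessThan_atLeast0 x_def b_def)
  qed
  \<comment> \<open>The Hermitian form of the Gram matrix at \<open>x\<close> is evaluated in two
    ways: as a |x|^2 and as |y|^2, where y = B^T x.\<close>
  have "a * (\<Sum>i<n. cnj (x i) * x i) = (\<Sum>i<n. cnj (x i) * (\<Sum>j<n. (\<Sum>l<m. b i l * b j l) * x j))"
    unfolding sum_distrib_left[of a] by (intro sum.cong refl) (simp only: e lessThan_iff mult.left_commute)
  also have "\<dots> = (\<Sum>i<n. \<Sum>j<n. \<Sum>l<m. (b i l * cnj (x i)) * (b j l * x j))"
    by (simp add: sum_distrib_left sum_distrib_right mult_ac)
  also have "\<dots> = (\<Sum>i<n. \<Sum>l<m. \<Sum>j<n. (b i l * cnj (x i)) * (b j l * x j))"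
    by (rule sum.cong[OF refl], rule sum.swap)
  also have "\<dots> = (\<Sum>l<m. \<Sum>i<n. \<Sum>j<n. (b i l * cnj (x i)) * (b j l * x j))"
    by (rule sum.swap)
  also have "\<dots> = (\<Sum>l<m. cnj (y l) * y l)"
    by (simp add: y_def sum_product b_def)
  finally have "a * complex_of_real (\<Sum>i<n. (cmod (x i))\<^sup>2) = complex_of_real (\<Sum>l<m. (cmod (y l))\<^sup>2)"
    by (simp only: of_real_sum complex_norm_square mult.commute)
  moreover have "(\<Sum>i<n. (cmod (x i))\<^sup>2) > 0"
  proof -
    obtain i where "i < n" "x i \<noteq> 0"
      using v(1,2) by (metis carrier_vecD eq_vecI index_zero_vec x_def)
    then show ?thesis
      by (intro sum_pos2[where i = i]) auto
  qed
  ultimately have "a = complex_of_real ((\<Sum>l<m. (cmod (y l))\<^sup>2) / (\<Sum>i<n. (cmod (x i))\<^sup>2))"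
    unfolding of_real_divide by (metis nonzero_eq_divide_eq of_real_eq_0_iff less_irrefl)
  then show ?thesis
    by (intro exI[of _ "(\<Sum>l<m. (cmod (y l))\<^sup>2) / (\<Sum>i<n. (cmod (x i))\<^sup>2)"])
       (auto intro!: divide_nonneg_nonneg sum_nonneg)
qed

text \<open>Over the complex numbers the polynomial splits, and all roots are real and nonnegative.
  Replacing them by their real parts gives a factorization that injectivity of the embedding carries
  back to the reals.\<close>

lemma char_poly_gram_splits:
  fixes B :: "real mat"
  assumes B: "B \<in> carrier_mat n m"
  obtains es where "char_poly (B * transpose_mat B) = (\<Prod>e\<leftarrow>es. [:- e, 1:])"
    "\<forall>e\<in>set es. 0 \<le> e"
proof -
  let ?G = "B * transpose_mat B"
  let ?c = complex_of_real
  interpret p: map_poly_inj_comm_ring_hom ?c ..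
  have G: "?G \<in> carrier_mat n n" using B by auto
  then have cG: "map_mat ?c ?G \<in> carrier_mat n n" by auto
  obtain as where as: "char_poly (map_mat ?c ?G) = (\<Prod>a\<leftarrow>as. [:- a, 1:])"
    using char_poly_factorized[OF cG] by blast
  have "\<exists>r\<ge>0. a = ?c r" if "a \<in> set as" for a
    using that as by (intro eigenvalue_gram_nonneg[OF B])
      (auto simp: eigenvalue_root_char_poly[OF cG] poly_prod_list prod_list_zero_iff)
  then have re: "0 \<le> Re a \<and> ?c (Re a) = a" if "a \<in> set as" for a
    using that by fastforce
  have "map_poly ?c (char_poly ?G) = (\<Prod>a\<leftarrow>as. [:- a, 1:])"
    unfolding as[symmetric] by (rule of_real_hom.char_poly_hom[OF G, symmetric])
  also have "\<dots> = (\<Prod>a\<leftarrow>as. map_poly ?c [:- Re a, 1:])"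
    using re by (intro arg_cong[where f = prod_list] map_cong) auto
  also have "\<dots> = map_poly ?c (\<Prod>e\<leftarrow>map Re as. [:- e, 1:])"
    by (simp add: p.hom_prod_list o_def)
  finally have "char_poly ?G = (\<Prod>e\<leftarrow>map Re as. [:- e, 1:])"
    by (rule p.injectivity)
  then show thesis
    by (rule that) (use re in auto)
qed

section \<open>Inequalities for sums of square roots\<close>

text \<open>The quadratic summed on the left vanishes at 0 and touches the square root at
  \<open>M\<close>. Only the first two moments of the list enter, and for a spectrum these are
  traces.\<close>

lemma sum_list_sqrt_ge:
  assumes "\<And>x. x \<in> set xs \<Longrightarrow> 0 \<le> x" and M: "0 < M"
  shows "3 * sum_list xs / (2 * sqrt M) - (\<Sum>x\<leftarrow>xs. x\<^sup>2) / (2 * M * sqrt M) \<le> (\<Sum>x\<leftarrow>xs. sqrt x)"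
proof -
  have "3 * x / (2 * sqrt M) - x\<^sup>2 / (2 * M * sqrt M) \<le> sqrt x" if x: "0 \<le> x" for x
  proof -
    define s r where "s = sqrt x" and "r = sqrt M"
    have s: "0 \<le> s" "x = s\<^sup>2" and r: "0 < r" "M = r\<^sup>2"
      using x M by (auto simp: s_def r_def)
    have "s - (3 * s\<^sup>2 / (2 * r) - (s\<^sup>2)\<^sup>2 / (2 * r\<^sup>2 * r)) = s * (s - r)\<^sup>2 * (s + 2 * r) / (2 * r ^ 3)"
      using r(1) by (simp add: field_simps power2_eq_square power3_eq_cube)
    also have "\<dots> \<ge> 0"
      using s r by (intro divide_nonneg_nonneg mult_nonneg_nonneg) auto
    finally show ?thesis
      unfolding s_def[symmetric] r_def[symmetric] unfolding s(2) r(2) by simp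
  qed
  then have "(\<Sum>x\<leftarrow>xs. 3 * x / (2 * sqrt M) - x\<^sup>2 / (2 * M * sqrt M)) \<le> (\<Sum>x\<leftarrow>xs. sqrt x)"
    using assms(1) by (intro sum_list_mono) auto
  moreover have "(\<Sum>x\<leftarrow>xs. 3 * x / (2 * sqrt M) - x\<^sup>2 / (2 * M * sqrt M))
      = 3 * sum_list xs / (2 * sqrt M) - (\<Sum>x\<leftarrow>xs. x\<^sup>2) / (2 * M * sqrt M)"
    by (induction xs) (simp_all add: add_divide_distrib ring_distribs)
  ultimately show ?thesis by simp
qed

text \<open>Cauchy-Schwarz against the all-ones vector.\<close>

lemma sum_list_sqrt_le:
  fixes xs :: "real list"
  assumes "\<And>x. x \<in> set xs \<Longrightarrow> 0 \<le> x"
  shows "(\<Sum>x\<leftarrow>xs. sqrt x) \<le> sqrt (length xs * sum_list xs)"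
proof -
  have "(\<Sum>i<length xs. sqrt (xs ! i) * 1)\<^sup>2 \<le> (\<Sum>i<length xs. (sqrt (xs ! i))\<^sup>2) * (\<Sum>i<length xs. 1\<^sup>2)"
    by (rule Cauchy_Schwarz_ineq_sum)
  also have "(\<Sum>i<length xs. (sqrt (xs ! i))\<^sup>2) = (\<Sum>i<length xs. xs ! i)"
    using assms by (intro sum.cong) auto
  finally show ?thesis
    by (intro real_le_rsqrt) (simp add: sum_list_sum_nth lessThan_atLeast0 mult.commute)
qed

text \<open>Cauchy-Schwarz on the entries other than \<open>x\<close> gives sqrt x + N sqrt (S - x),
  which decreases in x from the average of the list on. Since \<open>c\<close> is at least this
  average, \<open>x\<close> may be lowered to \<open>c\<close>.\<close>

lemma sum_list_sqrt_le_dominant: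
  fixes xs :: "real list" and c :: real
  assumes nonneg: "\<And>x. x \<in> set xs \<Longrightarrow> 0 \<le> x" and x: "x \<in> set xs" "c \<le> x"
    and c: "0 < c" "sum_list xs \<le> length xs * c"
  shows "(\<Sum>x\<leftarrow>xs. sqrt x) \<le> sqrt c + sqrt ((real (length xs) - 1) * (sum_list xs - c))"
proof -
  define S where "S = sum_list xs"
  define N where "N = sqrt (real (length xs) - 1)"
  have len: "real (length xs) - 1 = length (remove1 x xs)"
    using x(1) length_pos_if_in_set[OF x(1)] by (simp add: length_remove1 Suc_leI of_nat_diff)
  then have N: "0 \<le> N" "N\<^sup>2 = real (length xs) - 1"
    by (auto simp: N_def)
  have split: "mset xs = add_mset x (mset (remove1 x xs))"
    using x(1) by simp
  have S: "S = x + sum_list (remove1 x xs)"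
    unfolding S_def by (metis split sum_mset_sum_list sum_mset.add_mset)
  have "(\<Sum>x\<leftarrow>xs. sqrt x) = sum_mset (image_mset sqrt (mset xs))"
    by (metis mset_map sum_mset_sum_list)
  also have "\<dots> = sqrt x + (\<Sum>x\<leftarrow>remove1 x xs. sqrt x)"
    unfolding split by (metis image_mset_add_mset mset_map sum_mset.add_mset sum_mset_sum_list)
  also have "\<dots> \<le> sqrt x + sqrt (length (remove1 x xs) * sum_list (remove1 x xs))"
    using nonneg by (intro add_left_mono sum_list_sqrt_le) (meson notin_set_remove1)
  also have "\<dots> = sqrt x + N * sqrt (S - x)"
    unfolding len[symmetric] N_def by (simp add: S real_sqrt_mult)
  also have "\<dots> \<le> sqrt c + N * sqrt (S - c)"
  proof -
    define a b p q where abpq: "a = sqrt c" "b = sqrt x" "p = sqrt (S - c)" "q = sqrt (S - x)"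
    have Sx: "0 \<le> S - x"
      unfolding S using nonneg by (auto intro!: sum_list_nonneg dest: notin_set_remove1)
    have ab: "0 < a" "a \<le> b" and pq: "0 \<le> q" "q \<le> p"
      using c(1) x(2) Sx by (auto simp: abpq)
    have sq: "a\<^sup>2 = c" "b\<^sup>2 = x" "p\<^sup>2 = S - c" "q\<^sup>2 = S - x"
      using c(1) x(2) Sx by (auto simp: abpq)
    \<comment> \<open>That \<open>c\<close> is at least the average becomes
      \<open>p \<le> N * a\<close>; this takes the place of the sign of a derivative.\<close>
    have "S - c \<le> (real (length xs) - 1) * c"
      using c(2) by (simp add: S_def algebra_simps)
    then have "p\<^sup>2 \<le> (N * a)\<^sup>2"
      by (simp add: sq N(2) power_mult_distrib)
    then have "p \<le> N * a"
      by (rule power2_le_imp_le) (use N(1) ab in auto)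
    moreover have "N * a \<le> N * b"
      using N(1) ab by (intro mult_left_mono)
    ultimately have "p + q \<le> N * (a + b)"
      using pq by (simp add: ring_distribs)
    \<comment> \<open>As differences of squares, both sides equal x - c. Cancelling
      \<open>a + b\<close> below then gives the claim.\<close>
    have "(b - a) * (a + b) = (p - q) * (p + q)"
      using sq by (simp add: algebra_simps power2_eq_square)
    also have "\<dots> \<le> (p - q) * (N * (a + b))"
      using pq \<open>p + q \<le> N * (a + b)\<close> by (intro mult_left_mono) auto
    finally have "(b - a) * (a + b) \<le> ((p - q) * N) * (a + b)"
      by (simp add: mult_ac)
    then have "b - a \<le> (p - q) * N"
      using ab by (simp add: mult_le_cancel_right)
    then show ?thesis
      by (simp add: abpq[symmetric] algebra_simps)
  qed
  finally show ?thesis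
    by (simp add: N_def S_def real_sqrt_mult)
qed

section \<open>Codegrees and incidence energy of uniform hypergraphs\<close>

text \<open>These are the entries of the Gram matrix; the diagonal ones,
  \<open>codegree E u u\<close>, are the degrees.\<close>

definition codegree :: "'a set set \<Rightarrow> 'a \<Rightarrow> 'a \<Rightarrow> nat" where
  "codegree E u v = card {e \<in> E. u \<in> e \<and> v \<in> e}"

lemma card_supersets:
  assumes "finite V" "S \<subseteq> V" "card S \<le> k"
  shows "card {e. e \<subseteq> V \<and> card e = k \<and> S \<subseteq> e} = (card V - card S) choose (k - card S)"
proof -
  have fS: "finite S" using assms finite_subset by blast
  have "{e. e \<subseteq> V \<and> card e = k \<and> S \<subseteq> e} = (\<union>) S ` {B. B \<subseteq> V - S \<and> card B = k - card S}"
  proof (intro equalityI subsetI)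
    fix e assume "e \<in> {e. e \<subseteq> V \<and> card e = k \<and> S \<subseteq> e}"
    then have "e = S \<union> (e - S)" "e - S \<in> {B. B \<subseteq> V - S \<and> card B = k - card S}"
      using fS by (auto simp: card_Diff_subset)
    then show "e \<in> (\<union>) S ` {B. B \<subseteq> V - S \<and> card B = k - card S}" by blast
  next
    fix e assume "e \<in> (\<union>) S ` {B. B \<subseteq> V - S \<and> card B = k - card S}"
    then obtain B where B: "e = S \<union> B" "B \<subseteq> V - S" "card B = k - card S" by auto
    moreover have "finite B" using B(2) assms(1) finite_subset by blast
    then have "card (S \<union> B) = card S + card B"
      using B(2) fS by (intro card_Un_disjoint) auto
    ultimately show "e \<in> {e. e \<subseteq> V \<and> card e = k \<and> S \<subseteq> e}"
      using assms by auto
  qed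
  moreover have "inj_on ((\<union>) S) {B. B \<subseteq> V - S \<and> card B = k - card S}"
    by (rule inj_onI) blast
  ultimately show ?thesis
    using n_subsets[of "V - S" "k - card S"] assms fS by (simp add: card_image card_Diff_subset)
qed

text \<open>Interpreted for the hypergraph and again for its complement, so that each bound is
  proved once and serves both.\<close>

locale uniform =
  fixes k :: nat and V :: "'a set" and E :: "'a set set"
  assumes unif: "uniform_hypergraph k V E" and k2: "2 \<le> k"
begin

lemma finV: "finite V" and edge: "e \<in> E \<Longrightarrow> e \<subseteq> V \<and> card e = k"
  using unif by (auto simp: uniform_hypergraph_def hypergraph_def)

lemma finE: "finite E"
  using finV edge by (meson finite_Pow_iff finite_subset PowI subsetI)

text \<open>Double counting of the pairs (v, e) with u and v in e: each edge through
  \<open>u\<close> contributes its k vertices.\<close>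

lemma sum_codegree: "(\<Sum>v\<in>V. codegree E u v) = k * codegree E u u"
proof -
  have "(\<Sum>v\<in>V. codegree E u v) = (\<Sum>v\<in>V. \<Sum>e\<in>{e \<in> E. u \<in> e}. if v \<in> e then 1 else 0)"
    using finE by (auto simp: codegree_def sum.If_cases Int_def conj_ac intro!: sum.cong)
  also have "\<dots> = (\<Sum>e\<in>{e \<in> E. u \<in> e}. \<Sum>v\<in>V. if v \<in> e then 1 else 0)"
    by (rule sum.swap)
  also have "\<dots> = (\<Sum>e\<in>{e \<in> E. u \<in> e}. k)"
    using edge finV by (intro sum.cong) (auto simp: sum.If_cases Int_absorb1)
  finally show ?thesis by (simp add: codegree_def)
qed

lemma sum_degree: "(\<Sum>v\<in>V. codegree E v v) = k * card E"
proof -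
  have "(\<Sum>v\<in>V. codegree E v v) = (\<Sum>v\<in>V. \<Sum>e\<in>E. if v \<in> e then 1 else 0)"
    using finE by (auto simp: codegree_def sum.If_cases Int_def conj_ac intro!: sum.cong)
  also have "\<dots> = (\<Sum>e\<in>E. \<Sum>v\<in>V. if v \<in> e then 1 else 0)"
    by (rule sum.swap)
  also have "\<dots> = (\<Sum>e\<in>E. k)"
    using edge finV by (intro sum.cong) (auto simp: sum.If_cases Int_absorb1)
  finally show ?thesis by simp
qed

lemma codegree_le_degree: "codegree E u v \<le> codegree E u u"
  unfolding codegree_def using finE by (intro card_mono) auto

lemma card_edges_containing:
  "u \<in> V \<Longrightarrow> card {e. e \<subseteq> V \<and> card e = k \<and> u \<in> e} = (card V - 1) choose (k - 1)"
  using card_supersets[OF finV, of "{u}" k] k2 by simp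

lemma degree_le: "u \<in> V \<Longrightarrow> codegree E u u \<le> (card V - 1) choose (k - 1)"
  unfolding card_edges_containing[symmetric] codegree_def
  using finV edge by (intro card_mono) auto

text \<open>At full degree every k-subset through \<open>u\<close> is an edge, so the edges through
  \<open>u\<close> and \<open>v\<close> are all k-subsets containing both.\<close>

lemma codegree_if_degree_max:
  assumes "u \<in> V" "v \<in> V" "u \<noteq> v" "codegree E u u = (card V - 1) choose (k - 1)"
  shows "codegree E u v = (card V - 2) choose (k - 2)"
proof -
  have "{e \<in> E. u \<in> e} = {e. e \<subseteq> V \<and> card e = k \<and> u \<in> e}"
    using assms(1,4) card_edges_containing[OF assms(1)] edge finV
    by (intro card_subset_eq) (auto simp: codegree_def)
  then have "{e \<in> E. u \<in> e \<and> v \<in> e} = {e. e \<subseteq> V \<and> card e = k \<and> {u, v} \<subseteq> e}"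
    by auto
  then show ?thesis
    using card_supersets[OF finV, of "{u, v}" k] assms k2
    by (simp add: codegree_def numeral_2_eq_2)
qed

text \<open>One factor of each square is bounded by the degree of \<open>u\<close>; the remaining
  row sum is k times that degree.\<close>

lemma sum_codegree_squares_le:
  assumes "u \<in> V"
  shows "(\<Sum>v\<in>V. (codegree E u v)\<^sup>2) \<le> k * ((card V - 1) choose (k - 1)) * codegree E u u"
proof -
  have "(\<Sum>v\<in>V. (codegree E u v)\<^sup>2) \<le> (\<Sum>v\<in>V. codegree E u u * codegree E u v)"
    by (intro sum_mono) (simp add: power2_eq_square codegree_le_degree)
  also have "\<dots> = k * codegree E u u * codegree E u u"
    by (simp add: sum_distrib_left[symmetric] sum_codegree)
  also have "\<dots> \<le> k * ((card V - 1) choose (k - 1)) * codegree E u u"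
    using degree_le[OF assms] by simp
  finally show ?thesis .
qed

text \<open>Below the maximal degree the final estimate of the weak version is strict. At the
  maximal degree its first estimate is strict, since some codegree lies strictly between 0 and the
  degree.\<close>

lemma sum_codegree_squares_less:
  assumes u: "u \<in> V" and pos: "0 < codegree E u u" and n: "k < card V"
  shows "(\<Sum>v\<in>V. (codegree E u v)\<^sup>2) < k * ((card V - 1) choose (k - 1)) * codegree E u u"
proof (cases "codegree E u u = (card V - 1) choose (k - 1)")
  case False
  have "(\<Sum>v\<in>V. (codegree E u v)\<^sup>2) \<le> (\<Sum>v\<in>V. codegree E u u * codegree E u v)"
    by (intro sum_mono) (simp add: power2_eq_square codegree_le_degree)
  also have "\<dots> = k * codegree E u u * codegree E u u"
    by (simp add: sum_distrib_left[symmetric] sum_codegree)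
  also have "\<dots> < k * ((card V - 1) choose (k - 1)) * codegree E u u"
    using degree_le[OF u] False pos k2 by simp
  finally show ?thesis .
next
  case True
  have "\<not> V \<subseteq> {u}"
    using card_mono[of "{u}" V] n k2 by auto
  then obtain v where v: "v \<in> V" "u \<noteq> v" by auto
  have cv: "codegree E u v = (card V - 2) choose (k - 2)"
    by (rule codegree_if_degree_max[OF u v True])
  obtain N where N: "card V = Suc (Suc N)"
    using n k2 by (metis Suc_le_D Suc_le_mono numeral_2_eq_2 le_trans less_imp_le)
  obtain K where K: "k = Suc (Suc K)"
    using k2 by (metis Suc_le_D Suc_le_mono numeral_2_eq_2)
  \<comment> \<open>By Pascal's rule the difference is C(n-2, k-1), positive because k < n.
    Positivity of the codegree keeps the inequality strict after multiplying by it.\<close>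
  have "0 < codegree E u v" "codegree E u v < codegree E u u"
    using n unfolding cv True by (auto simp: N K)
  then have "(codegree E u v)\<^sup>2 < codegree E u u * codegree E u v"
    by (simp add: power2_eq_square)
  then have "(\<Sum>v\<in>V. (codegree E u v)\<^sup>2) < (\<Sum>v\<in>V. codegree E u u * codegree E u v)"
    using v finV by (intro sum_strict_mono_ex1)
      (auto simp: power2_eq_square codegree_le_degree)
  also have "\<dots> = k * codegree E u u * codegree E u u"
    by (simp add: sum_distrib_left[symmetric] sum_codegree)
  finally show ?thesis using True by simp
qed

section \<open>Spectral data and energy bounds for one hypergraph\<close>

lemma sum_nth_enumeration: "(\<Sum>i<card V. f (enumeration V ! i)) = sum f V"
  using sum.reindex_bij_betw[OF bij_betw_nth[OF enumeration(2)[OF finV] refl refl], of f]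
    distinct_card[OF enumeration(2)[OF finV]] by (simp add: enumeration(1)[OF finV])

text \<open>Here \<open>es\<close> lists the eigenvalues of the Gram matrix with multiplicity. The
  two bounds on the energy use only these properties, so matrices do not appear after this
  point.\<close>

lemma incidence_spectrum:
  assumes E: "E \<noteq> {}"
  obtains es :: "real list" where "length es = card V" "\<forall>e\<in>set es. 0 \<le> e"
    "incidence_energy V E = (\<Sum>e\<leftarrow>es. sqrt e)" "sum_list es = real (k * card E)"
    "(\<Sum>e\<leftarrow>es. e\<^sup>2) = real (\<Sum>u\<in>V. \<Sum>v\<in>V. (codegree E u v)\<^sup>2)"
    "\<exists>e\<in>set es. real (k\<^sup>2 * card E) \<le> e * real (card V)"
proof -
  define n where "n = card V"
  define vs where "vs = enumeration V"
  define B where "B = incidence_matrix vs (enumeration E)"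
  define G where "G = B * transpose_mat B"
  have vs: "length vs = n" "distinct vs" "set vs = V"
    using enumeration[OF finV] distinct_card[of "enumeration V"] by (auto simp: vs_def n_def)
  have B: "B \<in> carrier_mat n (length (enumeration E))"
    by (simp add: B_def incidence_matrix_def vs)
  then have G: "G \<in> carrier_mat n n" by (auto simp: G_def)
  have Gsym: "transpose_mat G = G"
    unfolding G_def using B by (subst transpose_mult[OF B]) auto
  have Gij: "G $$ (i, j) = real (codegree E (vs ! i) (vs ! j))" if "i < n" "j < n" for i j
    using that incidence_gram[OF enumeration(2)[OF finE], of vs] enumeration(1)[OF finE]
    by (simp add: G_def B_def vs codegree_def)
  have nth: "(\<Sum>i<n. f (vs ! i)) = sum f V" for f :: "'a \<Rightarrow> real"
    unfolding n_def vs_def by (rule sum_nth_enumeration)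
  obtain es where es: "char_poly G = (\<Prod>e\<leftarrow>es. [:- e, 1:])" and nonneg: "\<forall>e\<in>set es. 0 \<le> e"
    by (rule char_poly_gram_splits[OF B, folded G_def])
  have len: "length es = n"
    by (rule length_roots_char_poly[OF G es])
  have "proots (char_poly G) = mset es"
    unfolding es by (rule proots_prod_linear)
  then have 1: "incidence_energy V E = (\<Sum>e\<leftarrow>es. sqrt e)"
    using E unfolding incidence_energy_def singular_values_def
    by (simp add: B_def[symmetric] vs_def[symmetric] G_def[symmetric])
      (metis mset_map sum_mset_sum_list)
  have "sum_list es = trace_mat G"
    using trace_mat_eq_sum_roots[OF G es] by simp
  also have "\<dots> = (\<Sum>i<n. real (codegree E (vs ! i) (vs ! i)))"
    using G by (auto simp: trace_mat_def Gij)
  also have "\<dots> = real (k * card E)"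
    unfolding nth[of "\<lambda>v. real (codegree E v v)"] sum_degree[symmetric] by simp
  finally have 2: "sum_list es = real (k * card E)" .
  have nth2: "(\<Sum>i<n. \<Sum>j<n. f (vs ! i) (vs ! j)) = (\<Sum>u\<in>V. \<Sum>v\<in>V. f u v)"
    for f :: "'a \<Rightarrow> 'a \<Rightarrow> real"
    unfolding nth[of "f _"] by (rule nth)
  have "(\<Sum>e\<leftarrow>es. e\<^sup>2) = trace_mat (G * G)"
    using trace_mat_square_eq_sum_roots[OF G es] by simp
  also have "\<dots> = (\<Sum>i<n. \<Sum>j<n. (real (codegree E (vs ! i) (vs ! j)))\<^sup>2)"
    unfolding trace_mat_mult[OF G G]
    by (auto simp: Gij power2_eq_square codegree_def conj_commute intro!: sum.cong)
  also have "\<dots> = real (\<Sum>u\<in>V. \<Sum>v\<in>V. (codegree E u v)\<^sup>2)"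
    unfolding nth2[of "\<lambda>u v. (real (codegree E u v))\<^sup>2"] by simp
  finally have 3: "(\<Sum>e\<leftarrow>es. e\<^sup>2) = real (\<Sum>u\<in>V. \<Sum>v\<in>V. (codegree E u v)\<^sup>2)" .
  have "V \<noteq> {}"
    using E edge k2 by fastforce
  then have "es \<noteq> []" using len finV by (auto simp: n_def)
  then have Max: "Max (set es) \<in> set es" by simp
  \<comment> \<open>Rayleigh quotient of the all-ones vector: the form is the sum of all codegrees
    and the squared norm is \<open>n\<close>.\<close>
  have "quad_form G (\<lambda>_. 1) = (\<Sum>i<n. \<Sum>j<n. real (codegree E (vs ! i) (vs ! j)))"
    using G by (auto simp: quad_form_def Gij)
  also have "\<dots> = real (\<Sum>u\<in>V. \<Sum>v\<in>V. codegree E u v)"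
    unfolding nth2[of "\<lambda>u v. real (codegree E u v)"] by simp
  also have "(\<Sum>u\<in>V. \<Sum>v\<in>V. codegree E u v) = k\<^sup>2 * card E"
    unfolding sum_codegree sum_distrib_left[symmetric] sum_degree by (simp add: power2_eq_square)
  finally have "real (k\<^sup>2 * card E) = quad_form G (\<lambda>_. 1)" by simp
  also have "\<dots> \<le> Max (set es) * (\<Sum>i<n. 1\<^sup>2)"
    using nonneg Max by (intro quad_form_le_max_root[OF G Gsym es]) auto
  finally have "real (k\<^sup>2 * card E) \<le> Max (set es) * real (card V)"
    by (simp add: n_def)
  then have 4: "\<exists>e\<in>set es. real (k\<^sup>2 * card E) \<le> e * real (card V)"
    using Max by blast
  show thesis
    by (rule that[OF len[unfolded n_def] nonneg 1 2 3 4])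
qed

lemma card_le_if_edge: "E \<noteq> {} \<Longrightarrow> k \<le> card V"
  using edge finV card_mono by fastforce

lemma sum_sum_codegree_squares_le:
  "(\<Sum>u\<in>V. \<Sum>v\<in>V. (codegree E u v)\<^sup>2) \<le> k * ((card V - 1) choose (k - 1)) * (k * card E)"
  unfolding sum_degree[symmetric] sum_distrib_left by (intro sum_mono sum_codegree_squares_le)

text \<open>Any vertex of an edge has positive degree, and one strict row is enough.\<close>

lemma sum_sum_codegree_squares_less:
  assumes "E \<noteq> {}" "k < card V"
  shows "(\<Sum>u\<in>V. \<Sum>v\<in>V. (codegree E u v)\<^sup>2) < k * ((card V - 1) choose (k - 1)) * (k * card E)"
proof -
  obtain e where e: "e \<in> E" using assms by auto
  with edge k2 obtain u where u: "u \<in> e" by (metis card.empty equals0I not_numeral_le_zero)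
  have "0 < codegree E u u"
    using e u finE by (auto simp: codegree_def card_gt_0_iff)
  moreover have "u \<in> V" using e u edge by blast
  ultimately show ?thesis
    unfolding sum_degree[symmetric] sum_distrib_left using assms finV
    by (intro sum_strict_mono_ex1 ballI sum_codegree_squares_le)
      (blast intro: sum_codegree_squares_less)+
qed

lemma incidence_energy_ge:
  assumes E: "E \<noteq> {}"
  shows "k * card E / sqrt (k * ((card V - 1) choose (k - 1))) \<le> incidence_energy V E"
    and "k < card V \<Longrightarrow> k * card E / sqrt (k * ((card V - 1) choose (k - 1))) < incidence_energy V E"
proof -
  define M where "M = k * ((card V - 1) choose (k - 1))"
  define q where "q = (\<Sum>u\<in>V. \<Sum>v\<in>V. (codegree E u v)\<^sup>2)"
  have M: "0 < M"
    using k2 card_le_if_edge[OF E] by (simp add: M_def)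
  obtain es where es: "length es = card V" "\<forall>e\<in>set es. 0 \<le> e"
    "incidence_energy V E = (\<Sum>e\<leftarrow>es. sqrt e)" "sum_list es = real (k * card E)"
    "(\<Sum>e\<leftarrow>es. e\<^sup>2) = real q" "\<exists>e\<in>set es. real (k\<^sup>2 * card E) \<le> e * real (card V)"
    unfolding q_def by (rule incidence_spectrum[OF E])
  have "3 * real (k * card E) / (2 * sqrt M) - q / (2 * M * sqrt M) \<le> incidence_energy V E"
    using sum_list_sqrt_ge[OF es(2)[rule_format], of es "real M"] M by (simp add: es)
  \<comment> \<open>The excess over the target is a positive multiple of M tr G - tr G^2, so the
    double counting of codegrees decides both the weak and the strict bound.\<close>
  moreover have "3 * real (k * card E) / (2 * sqrt M) - q / (2 * M * sqrt M)
      = real (k * card E) / sqrt M + (real (M * (k * card E)) - q) / (2 * M * sqrt M)"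
    using M by (simp add: field_simps)
  ultimately have b: "real (k * card E) / sqrt M + (real (M * (k * card E)) - q) / (2 * M * sqrt M)
      \<le> incidence_energy V E" by simp
  have "real q \<le> real (M * (k * card E))"
    using sum_sum_codegree_squares_le unfolding M_def q_def of_nat_le_iff .
  then have "0 \<le> (real (M * (k * card E)) - q) / (2 * M * sqrt M)" by simp
  with b show "k * card E / sqrt (k * ((card V - 1) choose (k - 1))) \<le> incidence_energy V E"
    unfolding M_def by linarith
  assume "k < card V"
  then have "real q < real (M * (k * card E))"
    using sum_sum_codegree_squares_less[OF E] unfolding M_def q_def of_nat_less_iff by blast
  then have "0 < (real (M * (k * card E)) - q) / (2 * M * sqrt M)" using M by simp
  with b show "k * card E / sqrt (k * ((card V - 1) choose (k - 1))) < incidence_energy V E"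
    unfolding M_def by linarith
qed

text \<open>Both terms are multiples of the square root of the edge number, the form needed for
  adding the bounds of a hypergraph and its complement.\<close>

lemma incidence_energy_le:
  "incidence_energy V E
    \<le> k * sqrt (card E / card V)
      + sqrt (k * (real (card V) - 1) * (real (card V) - k) / card V) * sqrt (card E)"
proof (cases "E = {}")
  case True
  then show ?thesis by (simp add: incidence_energy_def)
next
  case False
  define n m where "n = real (card V)" and "m = real (card E)"
  define c where "c = k\<^sup>2 * m / n"
  have n: "real k \<le> n" "0 < n" and m: "0 < m"
    using card_le_if_edge[OF False] k2 False finE finV by (auto simp: n_def m_def card_gt_0_iff)
  obtain es where es: "length es = card V" "\<forall>e\<in>set es. 0 \<le> e"
    "incidence_energy V E = (\<Sum>e\<leftarrow>es. sqrt e)" "sum_list es = real (k * card E)"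
    "(\<Sum>e\<leftarrow>es. e\<^sup>2) = real (\<Sum>u\<in>V. \<Sum>v\<in>V. (codegree E u v)\<^sup>2)"
    "\<exists>e\<in>set es. real (k\<^sup>2 * card E) \<le> e * real (card V)"
    by (rule incidence_spectrum[OF False])
  from es(6) obtain x where x: "x \<in> set es" "real (k\<^sup>2 * card E) \<le> x * real (card V)"
    by blast
  have S: "sum_list es = k * m" by (simp add: es m_def)
  have "c \<le> x"
    using x(2) n by (simp add: c_def n_def m_def divide_le_eq)
  moreover have "0 < c" using n m k2 by (simp add: c_def)
  \<comment> \<open>The mean eigenvalue k m / n is at most c = k^2 m / n.\<close>
  moreover have "sum_list es \<le> length es * c"
    unfolding S es(1) n_def[symmetric] c_def using n m k2
    by (simp add: power2_eq_square)
  ultimately have "incidence_energy V E \<le> sqrt c + sqrt ((n - 1) * (k * m - c))"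
    using sum_list_sqrt_le_dominant[OF es(2)[rule_format] x(1)] unfolding S es(1,3) n_def by simp
  also have "sqrt c = k * sqrt (m / n)"
    by (simp add: c_def real_sqrt_mult real_sqrt_divide)
  also have "(n - 1) * (k * m - c) = k * (n - 1) * (n - k) / n * m"
    using n by (simp add: c_def field_simps power2_eq_square)
  finally show ?thesis
    by (simp only: n_def m_def real_sqrt_mult[of _ "real (card E)"])
qed

end

section \<open>Adding the bounds for a hypergraph and its complement\<close>

lemma sqrt_add_sqrt_le: "0 \<le> x \<Longrightarrow> 0 \<le> y \<Longrightarrow> sqrt x + sqrt y \<le> sqrt (2 * (x + y))"
  using sum_list_sqrt_le[of "[x, y]"] by auto

lemma uniform_complement:
  "uniform k V E \<Longrightarrow> uniform k V (complement_edges k V E)"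
  by (auto simp: uniform_def uniform_hypergraph_def hypergraph_def complement_edges_def)

lemma (in uniform) card_complement:
  "card E + card (complement_edges k V E) = card V choose k"
proof -
  have "{e. e \<subseteq> V \<and> card e = k} = E \<union> complement_edges k V E"
    using edge by (auto simp: complement_edges_def)
  moreover have "finite (complement_edges k V E)"
    using finV by (auto simp: complement_edges_def)
  then have "card (E \<union> complement_edges k V E) = card E + card (complement_edges k V E)"
    using finE by (intro card_Un_disjoint) (auto simp: complement_edges_def)
  ultimately show ?thesis
    using n_subsets[OF finV, of k] by simp
qed

text \<open>In the equality condition "at most" governs the edges too: for n = k, both the edgeless
  hypergraph and its one-edge complement attain equality. For n < k the denominator on the left is
  0, and division by zero yields 0, which matches the energies.\<close>

theorem theorem23:
  fixes V :: "'a set" and E :: "'a set set" and k n :: nat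
  assumes "k \<ge> 2" and "uniform_hypergraph k V E" and "card V = n"
  shows "sqrt (real k) * real (n choose k) / sqrt (real ((n - 1) choose (k - 1)))
           \<le> incidence_energy V E + incidence_energy V (complement_edges k V E)
       \<and> incidence_energy V E + incidence_energy V (complement_edges k V E)
           \<le> real k * sqrt (2 / real n * real (n choose k))
             + sqrt (2 * real k * (real n - 1) * (real n - real k) / real n * real (n choose k))
       \<and> (sqrt (real k) * real (n choose k) / sqrt (real ((n - 1) choose (k - 1)))
             = incidence_energy V E + incidence_energy V (complement_edges k V E)
           \<longleftrightarrow> n \<le> k \<and> card E \<le> 1)"
proof -
  interpret H: uniform k V E by unfold_locales fact+
  define F where "F = complement_edges k V E"
  interpret F: uniform k V F
    unfolding F_def by (rule uniform_complement) (rule H.uniform_axioms)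
  define D where "D = (n - 1) choose (k - 1)"
  \<comment> \<open>The lower bound is linear in the edge number with this common slope, so the two
    bounds add up to \<open>a\<close> times C(n, k).\<close>
  define a where "a = real k / sqrt (k * D)"
  have EF: "card E + card F = n choose k"
    using H.card_complement assms(3) by (simp add: F_def)
  then have EF': "real (card E) + real (card F) = real (n choose k)"
    by (metis of_nat_add)
  have L: "sqrt k * (n choose k) / sqrt D = a * card E + a * card F"
    unfolding distrib_left[symmetric] EF' a_def using assms(1)
    by (simp add: real_sqrt_mult real_div_sqrt flip: divide_divide_eq_left)
  have lowE: "a * card E \<le> incidence_energy V E"
    using H.incidence_energy_ge(1) assms(3)
    by (cases "E = {}") (auto simp: a_def D_def incidence_energy_def)
  have lowF: "a * card F \<le> incidence_energy V F"
    using F.incidence_energy_ge(1) assms(3)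
    by (cases "F = {}") (auto simp: a_def D_def incidence_energy_def)
  have ub: "incidence_energy V E + incidence_energy V F
      \<le> real k * sqrt (2 / real n * real (n choose k))
        + sqrt (2 * real k * (real n - 1) * (real n - real k) / real n * real (n choose k))"
  \<comment> \<open>For n < k the factor n - k is negative, whereas the argument for the other case
    multiplies by a nonnegative \<open>sqrt b\<close>.\<close>
  proof (cases "n < k")
    case True
    then have z: "n choose k = 0" by simp
    with EF have "E = {}" "F = {}" using H.finE F.finE by auto
    then show ?thesis unfolding z by (simp add: incidence_energy_def)
  next
    case False
    define b where "b = real k * (real n - 1) * (real n - k) / n"
    have b: "0 \<le> b" using False assms(1) by (simp add: b_def)
    have s: "sqrt (card E) + sqrt (card F) \<le> sqrt (2 * real (n choose k))"
      using sqrt_add_sqrt_le[of "card E" "card F"] EF' by simp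
    have "incidence_energy V E + incidence_energy V F
        \<le> k / sqrt n * (sqrt (card E) + sqrt (card F)) + sqrt b * (sqrt (card E) + sqrt (card F))"
      using H.incidence_energy_le[unfolded assms(3), folded b_def]
        F.incidence_energy_le[unfolded assms(3), folded b_def]
      by (simp add: real_sqrt_divide ring_distribs)
    also have "\<dots> \<le> k / sqrt n * sqrt (2 * real (n choose k)) + sqrt b * sqrt (2 * real (n choose k))"
      using b by (intro add_mono mult_left_mono s) auto
    also have "k / sqrt n * sqrt (2 * real (n choose k)) = k * sqrt (2 / real n * real (n choose k))"
      by (simp add: real_sqrt_mult real_sqrt_divide)
    also have "sqrt b * sqrt (2 * real (n choose k))
        = sqrt (2 * real k * (real n - 1) * (real n - real k) / real n * real (n choose k))"
      by (simp add: b_def mult_ac flip: real_sqrt_mult)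
    finally show ?thesis by simp
  qed
  have "a * card E + a * card F = incidence_energy V E + incidence_energy V F
      \<longleftrightarrow> n \<le> k \<and> card E \<le> 1"
  proof (cases "k < n")
    case True
    then have "n choose k \<noteq> 0" by simp
    \<comment> \<open>Some k-subset exists and lies in \<open>E\<close> or \<open>F\<close>; the
      lower bound for that one is strict.\<close>
    then have "E \<noteq> {} \<or> F \<noteq> {}" using EF by auto
    then have "a * card E < incidence_energy V E \<or> a * card F < incidence_energy V F"
      using H.incidence_energy_ge(2) F.incidence_energy_ge(2) True assms(3)
      by (auto simp: a_def D_def)
    with lowE lowF True show ?thesis by linarith
  next
    case False
    then have c: "n choose k \<le> 1"
      by (cases "n = k") (auto simp: binomial_eq_0)
    \<comment> \<open>With at most one edge in total, the lower and upper bounds for each of the two energies agree.\<close>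
    have eq: "incidence_energy V X = a * card X" if "uniform k V X" "card X \<le> 1" for X
    proof (cases "X = {}")
      case True
      then show ?thesis by (simp add: incidence_energy_def)
    next
      case ne: False
      interpret X: uniform k V X by fact
      have "card X = 1" using that(2) ne X.finE by (simp add: le_Suc_eq)
      moreover have "n = k" using X.card_le_if_edge[OF ne] False assms(3) by simp
      ultimately show ?thesis
        using X.incidence_energy_le X.incidence_energy_ge(1)[OF ne] assms(1,3)
        by (simp add: a_def D_def real_sqrt_divide)
    qed
    have "card E \<le> 1" "card F \<le> 1" using EF c by auto
    then show ?thesis
      using eq[OF H.uniform_axioms] eq[OF F.uniform_axioms] False by simp
  qed
  with ub lowE lowF show ?thesis
    unfolding L[unfolded D_def] F_def[symmetric] by auto
qed

end
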